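(* Let $1\le p<\infty$ and let $v\in L^0(m)$ be a nonnegative function on $\mathbb{R}^n$ (possibly vanishing on a set of positive measure). Define $$\|f\|_{L^p_v(\mathbb{R}^n)}:=\left(\int_{\mathbb{R}^n}|f(x)|^pv(x)\,dx\right)^{1/p}.$$ Let $\mathcal{F}\subset L^p_v(\mathbb{R}^n)$ be a family satisfying the following conditions: (a) $\mathcal{F}$ is bounded, i.e. $\sup_{f\in\mathcal{F}}\|f\|_{L^p_v(\mathbb{R}^n)}<\infty$; (b) $\mathcal{F}$ uniformly vanishes at infinity, that is, $\lim_{N\to\infty}\sup_{f\in\mathcal{F}}\|f\chi_{B^c(0,N)}\|_{L^p_v(\mathbb{R}^n)}=0$; (c) $\mathcal{F}$ is equicontinuous, that is, $\lim_{r\to0}\sup_{f\in\mathcal{F}}\sup_{y\in B(0,r)}\|\tau_yf-f\|_{L^p_v(\mathbb{R}^n)}=0$. Then $\mathcal{F}$ is a totally bounded subset of $L^p_v(\mathbb{R}^n)$.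
   Context: $m$ is Lebesgue measure on $\mathbb{R}^n$; $L^0(m)$ is the class of Lebesgue measurable functions on $\mathbb{R}^n$ that are finite almost everywhere (functions equal Lebesgue-a.e. are identified). $L^p_v(\mathbb{R}^n)$ is the set of $f\in L^0(m)$ with $\|f\|_{L^p_v(\mathbb{R}^n)}<\infty$; since $v$ may vanish on a set of positive measure, $\|\cdot\|_{L^p_v(\mathbb{R}^n)}$ is in general only a seminorm, and total boundedness is understood with respect to it (for every $\epsilon>0$ there is a finite $\epsilon$-net). $B(0,r)$ is the open Euclidean ball of radius $r$ centered at $0$, $B^c(0,N)=\mathbb{R}^n\setminus B(0,N)$, $\chi_A$ is the indicator function of $A$, and $\tau_yf(x)=f(x-y)$. *)

theory Defs
  imports "HOL-Analysis.Analysis"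
begin

(* Elements of L^0(m) are represented by everywhere finite functions: a measurable function
   that is finite almost everywhere agrees almost everywhere with such a function, and all
   notions below are invariant under changes on Lebesgue null sets.  The value type is a
   finite-dimensional normed field, that is, the real or the complex numbers. *)

definition L0 :: "(real ^ 'n \<Rightarrow> 'b::{real_normed_field, euclidean_space}) set" where
  "L0 = borel_measurable lebesgue"

definition ennreal_root :: "real \<Rightarrow> ennreal \<Rightarrow> ennreal" where
  "ennreal_root p a = (if a = \<infinity> then \<infinity> else ennreal (enn2real a powr (1 / p)))"

(* The value is infinite exactly when the integral diverges. *)
definition wnorm ::
  "real \<Rightarrow> (real ^ 'n \<Rightarrow> real) \<Rightarrow> (real ^ 'n \<Rightarrow> 'b::{real_normed_field, euclidean_space}) \<Rightarrow> ennreal"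
  where "wnorm p v f =
    ennreal_root p (\<integral>\<^sup>+ x. ennreal (norm (f x) powr p * v x) \<partial>lebesgue)"

definition Lpv ::
  "real \<Rightarrow> (real ^ 'n \<Rightarrow> real) \<Rightarrow> (real ^ 'n \<Rightarrow> 'b::{real_normed_field, euclidean_space}) set"
  where "Lpv p v = {f \<in> L0. wnorm p v f < \<infinity>}"

definition translation :: "real ^ 'n \<Rightarrow> (real ^ 'n \<Rightarrow> 'b) \<Rightarrow> real ^ 'n \<Rightarrow> 'b" where
  "translation y f = (\<lambda>x. f (x - y))"

(* The library's total boundedness presupposes a metric, while wnorm is only a seminorm.
   As in the library's mtotally_bounded, the net is taken inside the set itself. *)
definition Lpv_totally_bounded ::
  "real \<Rightarrow> (real ^ 'n \<Rightarrow> real) \<Rightarrow> (real ^ 'n \<Rightarrow> 'b::{real_normed_field, euclidean_space}) set \<Rightarrow> bool"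
  where "Lpv_totally_bounded p v F \<longleftrightarrow>
    F \<subseteq> Lpv p v \<and>
    (\<forall>\<epsilon>>0. \<exists>K. finite K \<and> K \<subseteq> F \<and>
      (\<forall>f\<in>F. \<exists>g\<in>K. wnorm p v (\<lambda>x. f x - g x) < ennreal \<epsilon>))"

end

theory Submission
  imports Defs
begin

text \<open>Cut a large ball into cubes \<open>Q\<close> small compared with the radius of equicontinuity.  Averaging
  \<open>\<integral>\<^sub>Q |f(x) - f(z)|\<^sup>p v(x) dx\<close> over \<open>z \<in> Q\<close> and summing over \<open>Q\<close> is controlled, by Fubini, by the
  translation differences of \<open>f\<close>, so for suitable points \<open>z\<close> depending on \<open>f\<close> and \<open>Q\<close> the step function
  with values \<open>f(z)\<close> is uniformly close to \<open>f\<close> in \<open>L\<^sup>p\<^sub>v\<close>.  Its norm is then bounded, which bounds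
  \<open>|f(z)|\<^sup>p v(Q)\<close> and forces \<open>f(z) = 0\<close> when \<open>v(Q) = \<infinity>\<close>; so the step functions form a bounded family in a
  finite-dimensional space.\<close>

section \<open>Weighted integrals of p-th powers\<close>

text \<open>The p-th power of the seminorm restricted to \<open>S\<close>; without the root it is
  additive over disjoint sets. Using \<open>lborel\<close> instead of the completed measure lets
  Fubini apply to Borel integrands in two variables.\<close>

definition wint ::
  "real \<Rightarrow> ('a::euclidean_space \<Rightarrow> real) \<Rightarrow> 'a set \<Rightarrow> ('a \<Rightarrow> 'b::euclidean_space) \<Rightarrow> ennreal"
  where "wint p v S f = (\<integral>\<^sup>+x\<in>S. ennreal (norm (f x) powr p * v x) \<partial>lborel)"

lemma norm_add_powr_le:
  fixes a b :: "'a::real_normed_vector"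
  assumes "0 \<le> p"
  shows "norm (a + b) powr p \<le> 2 powr p * (norm a powr p + norm b powr p)"
proof -
  have "norm (a + b) powr p \<le> (2 * max (norm a) (norm b)) powr p"
    using assms norm_triangle_ineq[of a b] by (intro powr_mono2) auto
  also have "\<dots> = 2 powr p * max (norm a) (norm b) powr p"
    by (simp add: powr_mult)
  also have "max (norm a) (norm b) powr p \<le> norm a powr p + norm b powr p"
    by (simp add: max_def)
  finally show ?thesis by simp
qed

text \<open>A substitute for Minkowski's inequality: bounding a sum pointwise by twice the larger
  norm costs only the constant \<open>2 powr p\<close>.\<close>

lemma wint_add_le:
  assumes [measurable]: "v \<in> borel_measurable borel" "f \<in> borel_measurable borel"
      "g \<in> borel_measurable borel" "S \<in> sets borel"
    and "\<And>x. 0 \<le> v x" "0 \<le> p"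
  shows "wint p v S (\<lambda>x. f x + g x) \<le> ennreal (2 powr p) * (wint p v S f + wint p v S g)"
proof -
  have "wint p v S (\<lambda>x. f x + g x) \<le>
    (\<integral>\<^sup>+x. ennreal (2 powr p) * (ennreal (norm (f x) powr p * v x) * indicator S x
        + ennreal (norm (g x) powr p * v x) * indicator S x) \<partial>lborel)"
    unfolding wint_def
  proof (intro nn_integral_mono)
    fix x
    have "norm (f x + g x) powr p * v x \<le> 2 powr p * (norm (f x) powr p * v x + norm (g x) powr p * v x)"
      using mult_right_mono[OF norm_add_powr_le[OF assms(6)] assms(5), of "f x" "g x" x]
      by (simp add: algebra_simps)
    then have "ennreal (norm (f x + g x) powr p * v x) \<le>
      ennreal (2 powr p) * (ennreal (norm (f x) powr p * v x) + ennreal (norm (g x) powr p * v x))"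
      using assms(5) by (simp flip: ennreal_plus ennreal_mult)
    then show "ennreal (norm (f x + g x) powr p * v x) * indicator S x \<le> ennreal (2 powr p) *
      (ennreal (norm (f x) powr p * v x) * indicator S x + ennreal (norm (g x) powr p * v x) * indicator S x)"
      by (auto split: split_indicator)
  qed
  also have "\<dots> = ennreal (2 powr p) * (wint p v S f + wint p v S g)"
    unfolding wint_def by (simp add: nn_integral_cmult nn_integral_add)
  finally show ?thesis .
qed

lemma wint_minus_commute: "wint p v S (\<lambda>x. f x - g x) = wint p v S (\<lambda>x. g x - f x)"
  by (simp add: wint_def norm_minus_commute)

lemma wint_mono_set: "S \<subseteq> T \<Longrightarrow> wint p v S f \<le> wint p v T f"
  unfolding wint_def by (intro nn_integral_mono) (auto split: split_indicator)

lemma wint_cong: "(\<And>x. x \<in> S \<Longrightarrow> f x = g x) \<Longrightarrow> wint p v S f = wint p v S g"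
  unfolding wint_def by (intro nn_integral_cong) (auto split: split_indicator)

lemma wint_UN_disjoint:
  assumes [measurable]: "v \<in> borel_measurable borel" "f \<in> borel_measurable borel"
    and "finite I" "\<And>k. k \<in> I \<Longrightarrow> Q k \<in> sets borel" "disjoint_family_on Q I"
  shows "wint p v (\<Union>k\<in>I. Q k) f = (\<Sum>k\<in>I. wint p v (Q k) f)"
proof -
  have *: "indicator (\<Union>k\<in>I. Q k) x = (\<Sum>k\<in>I. indicator (Q k) x :: ennreal)" for x
    by (rule indicator_UN_disjoint) (use assms in auto)
  show ?thesis
    unfolding wint_def * sum_distrib_left
    by (rule nn_integral_sum) (use assms(4) in measurable)
qed

lemma wint_Compl:
  assumes [measurable]: "v \<in> borel_measurable borel" "f \<in> borel_measurable borel" "S \<in> sets borel"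
  shows "wint p v UNIV f = wint p v S f + wint p v (- S) f"
  unfolding wint_def
  by (subst nn_integral_add[symmetric]) (auto intro!: nn_integral_cong split: split_indicator)

lemma wint_const:
  assumes [measurable]: "v \<in> borel_measurable borel" "S \<in> sets borel" and "\<And>x. 0 \<le> v x"
  shows "wint p v S (\<lambda>_. c) = ennreal (norm c powr p) * (\<integral>\<^sup>+x\<in>S. ennreal (v x) \<partial>lborel)"
  unfolding wint_def
  by (subst nn_integral_cmult[symmetric])
    (auto simp: ennreal_mult' mult.assoc assms(3) intro!: nn_integral_cong)

section \<open>Approximation on cells by means of translations\<close>

lemma nn_integral_lborel_reflect:
  fixes h :: "'a::euclidean_space \<Rightarrow> ennreal"
  assumes [measurable]: "h \<in> borel_measurable borel"
  shows "(\<integral>\<^sup>+y. h (x - y) \<partial>lborel) = (\<integral>\<^sup>+z. h z \<partial>lborel)"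
proof -
  have "lborel = distr lborel borel (\<lambda>y. x - y)"
    using lborel_affine[of "-1" x] by (simp add: density_1)
  then have "(\<integral>\<^sup>+z. h z \<partial>lborel) = (\<integral>\<^sup>+z. h z \<partial>distr lborel borel (\<lambda>y. x - y))"
    by simp
  then show ?thesis by (simp add: nn_integral_distr)
qed

text \<open>Since \<open>f\<close> need not be locally integrable, the approximating constant is a value \<open>f z\<close> at a
  well chosen point rather than an average.\<close>

lemma exists_constant_approximation:
  fixes f :: "'a::euclidean_space \<Rightarrow> 'b::euclidean_space"
  assumes [measurable]: "v \<in> borel_measurable borel" "f \<in> borel_measurable borel"
      "P \<in> sets borel" "Q \<in> sets borel"
    and q: "emeasure lborel P = ennreal q" "0 < q"
  shows "\<exists>z\<in>P. ennreal q * wint p v Q (\<lambda>x. f x - f z) \<le>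
    (\<integral>\<^sup>+z\<in>P. wint p v Q (\<lambda>x. f x - f z) \<partial>lborel)"
proof (rule ccontr)
  let ?g = "\<lambda>z. wint p v Q (\<lambda>x. f x - f z)"
  let ?T = "\<integral>\<^sup>+z\<in>P. ?g z \<partial>lborel"
  assume *: "\<not> ?thesis"
  \<comment> \<open>If every \<open>z\<close> in \<open>P\<close> fails, integrating this strict
    inequality over \<open>P\<close>, whose measure is \<open>q\<close>, yields
    \<open>q * ?T < q * ?T\<close>.\<close>
  then have gt: "?T < ennreal q * ?g z" if "z \<in> P" for z
    using that by (meson not_le)
  have g[measurable]: "?g \<in> borel_measurable borel"
    unfolding wint_def by measurable
  have "P \<noteq> {}" using q by auto
  then obtain z where "z \<in> P" by blast
  \<comment> \<open>The strict bound at a single point already makes \<open>?T\<close> finite, as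
    strict monotonicity of the integral requires.\<close>
  then have fin: "?T < \<infinity>" using less_le_trans[OF gt top_greatest] by simp
  have "(\<integral>\<^sup>+z. ?T * indicator P z \<partial>lborel) < (\<integral>\<^sup>+z. ennreal q * (?g z * indicator P z) \<partial>lborel)"
  proof (rule nn_integral_less)
    show "(\<integral>\<^sup>+z. ?T * indicator P z \<partial>lborel) \<noteq> \<infinity>"
      using fin q by (simp add: nn_integral_cmult_indicator ennreal_mult_eq_top_iff)
    show "AE z in lborel. ?T * indicator P z \<le> ennreal q * (?g z * indicator P z)"
      using gt by (intro AE_I2) (auto split: split_indicator intro: less_imp_le)
    \<comment> \<open>The inequality is strict on all of \<open>P\<close>, so its reverse could hold
      almost everywhere only if \<open>P\<close> were null.\<close>
    show "\<not> (AE z in lborel. ennreal q * (?g z * indicator P z) \<le> ?T * indicator P z)"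
    proof
      assume "AE z in lborel. ennreal q * (?g z * indicator P z) \<le> ?T * indicator P z"
      then have "AE z in lborel. z \<notin> P"
        by (rule AE_mp) (use gt in \<open>auto intro!: AE_I2 simp: not_le[symmetric]\<close>)
      then have "emeasure lborel P = 0"
        by (subst (asm) AE_iff_measurable[of P]) auto
      with q show False by simp
    qed
  qed (measurable)
  also have "\<dots> = ennreal q * ?T" by (rule nn_integral_cmult) measurable
  finally have "?T * emeasure lborel P < ennreal q * ?T"
    by (subst (asm) nn_integral_cmult_indicator) auto
  then show False using q by (simp add: mult.commute)
qed

text \<open>The double integrals over the pairs \<open>(P k, Q k)\<close> add up to at most one integral over the pairs
  at distance less than \<open>r\<close>, which the substitution \<open>z = x - y\<close> turns into an average of translation
  differences.\<close>

lemma sum_wint_le_translation: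
  fixes f :: "'a::euclidean_space \<Rightarrow> 'b::euclidean_space"
  assumes [measurable]: "v \<in> borel_measurable borel" "f \<in> borel_measurable borel"
    and I: "finite I" "\<And>k. k \<in> I \<Longrightarrow> P k \<in> sets borel" "\<And>k. k \<in> I \<Longrightarrow> Q k \<in> sets borel"
      "disjoint_family_on Q I"
    and near: "\<And>k x z. k \<in> I \<Longrightarrow> z \<in> P k \<Longrightarrow> x \<in> Q k \<Longrightarrow> dist x z < r"
    and transl: "\<And>y. y \<in> ball 0 r \<Longrightarrow> wint p v UNIV (\<lambda>x. f (x - y) - f x) \<le> e"
  shows "(\<Sum>k\<in>I. \<integral>\<^sup>+z\<in>P k. wint p v (Q k) (\<lambda>x. f x - f z) \<partial>lborel)
    \<le> e * emeasure lborel (ball 0 r :: 'a set)"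
proof -
  let ?G = "\<lambda>x z. ennreal (norm (f x - f z) powr p * v x)"
  let ?B = "ball 0 r :: 'a set"
  note [measurable] = I(2,3)
  have [measurable]: "Measurable.pred (borel \<Otimes>\<^sub>M borel) (\<lambda>w. fst w - snd w \<in> ?B)"
    unfolding mem_ball dist_norm by measurable
  have [measurable]: "Measurable.pred (borel \<Otimes>\<^sub>M borel) (\<lambda>w :: 'a \<times> 'a. snd w \<in> ?B)"
    unfolding mem_ball dist_norm by measurable
  have "(\<Sum>k\<in>I. \<integral>\<^sup>+z\<in>P k. wint p v (Q k) (\<lambda>x. f x - f z) \<partial>lborel)
    = (\<Sum>k\<in>I. \<integral>\<^sup>+z. \<integral>\<^sup>+x. ?G x z * indicator (Q k) x * indicator (P k) z \<partial>lborel \<partial>lborel)"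
    unfolding wint_def by (intro sum.cong nn_integral_cong) (auto simp: nn_integral_multc)
  also have "\<dots> = (\<integral>\<^sup>+z. \<integral>\<^sup>+x. (\<Sum>k\<in>I. ?G x z * indicator (Q k) x * indicator (P k) z) \<partial>lborel \<partial>lborel)"
    by (simp add: nn_integral_sum)
  \<comment> \<open>As the \<open>Q k\<close> are disjoint, at most one summand survives for fixed
    \<open>x\<close> and \<open>z\<close>, and then \<open>x - z\<close> lies in the ball.\<close>
  also have "\<dots> \<le> (\<integral>\<^sup>+z. \<integral>\<^sup>+x. ?G x z * indicator ?B (x - z) \<partial>lborel \<partial>lborel)"
  proof (intro nn_integral_mono)
    fix x z
    show "(\<Sum>k\<in>I. ?G x z * indicator (Q k) x * indicator (P k) z) \<le> ?G x z * indicator ?B (x - z)"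
    proof (cases "\<exists>k\<in>I. x \<in> Q k \<and> z \<in> P k")
      case True
      then obtain k where k: "k \<in> I" "x \<in> Q k" "z \<in> P k" by auto
      have "(\<Sum>j\<in>I. ?G x z * indicator (Q j) x * indicator (P j) z)
        = (\<Sum>j\<in>I. if j = k then ?G x z else 0)"
        using k I(4) by (intro sum.cong) (auto simp: disjoint_family_on_def split: split_indicator)
      also have "\<dots> = ?G x z" using k I by simp
      finally show ?thesis using near[OF k(1,3,2)] by (simp add: dist_norm norm_minus_commute)
    next
      case False
      then have "(\<Sum>j\<in>I. ?G x z * indicator (Q j) x * indicator (P j) z) = 0"
        by (intro sum.neutral) (auto split: split_indicator)
      then show ?thesis by simp
    qed
  qed
  \<comment> \<open>With \<open>x\<close> outermost, \<open>z\<close> can be replaced by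
    \<open>x - y\<close>; the second exchange then puts \<open>y\<close> outermost, so that the
    inner integral is a translation difference.\<close>
  also have "\<dots> = (\<integral>\<^sup>+x. \<integral>\<^sup>+z. ?G x z * indicator ?B (x - z) \<partial>lborel \<partial>lborel)"
    by (rule lborel_pair.Fubini') measurable
  also have "\<dots> = (\<integral>\<^sup>+x. \<integral>\<^sup>+y. ?G x (x - y) * indicator ?B y \<partial>lborel \<partial>lborel)"
  proof (rule nn_integral_cong)
    fix x
    have [measurable]: "Measurable.pred borel (\<lambda>z. x - z \<in> ?B)"
      unfolding mem_ball dist_norm by measurable
    show "(\<integral>\<^sup>+z. ?G x z * indicator ?B (x - z) \<partial>lborel) = (\<integral>\<^sup>+y. ?G x (x - y) * indicator ?B y \<partial>lborel)"
      using nn_integral_lborel_reflect[of "\<lambda>z. ?G x z * indicator ?B (x - z)" x] by simp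
  qed
  also have "\<dots> = (\<integral>\<^sup>+y. \<integral>\<^sup>+x. ?G x (x - y) * indicator ?B y \<partial>lborel \<partial>lborel)"
    by (rule lborel_pair.Fubini'[symmetric]) measurable
  also have "\<dots> = (\<integral>\<^sup>+y\<in>?B. wint p v UNIV (\<lambda>x. f (x - y) - f x) \<partial>lborel)"
    unfolding wint_def by (simp add: nn_integral_multc norm_minus_commute)
  also have "\<dots> \<le> (\<integral>\<^sup>+y. e * indicator ?B y \<partial>lborel)"
    using transl by (intro nn_integral_mono) (auto split: split_indicator)
  also have "\<dots> = e * emeasure lborel ?B" by (simp add: nn_integral_cmult_indicator)
  finally show ?thesis .
qed

text \<open>All \<open>P k\<close> have the same measure \<open>q\<close>, so this factor leaves the
  sum, and the constants chosen cell by cell are controlled together by the translation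
  bound.\<close>

lemma exists_step_approximation:
  fixes f :: "'a::euclidean_space \<Rightarrow> 'b::euclidean_space"
  assumes [measurable]: "v \<in> borel_measurable borel" "f \<in> borel_measurable borel"
    and I: "finite I" "\<And>k. k \<in> I \<Longrightarrow> P k \<in> sets borel" "\<And>k. k \<in> I \<Longrightarrow> Q k \<in> sets borel"
      "disjoint_family_on Q I"
    and q: "\<And>k. k \<in> I \<Longrightarrow> emeasure lborel (P k) = ennreal q" "0 < q"
    and near: "\<And>k x z. k \<in> I \<Longrightarrow> z \<in> P k \<Longrightarrow> x \<in> Q k \<Longrightarrow> dist x z < r"
    and transl: "\<And>y. y \<in> ball 0 r \<Longrightarrow> wint p v UNIV (\<lambda>x. f (x - y) - f x) \<le> e"
  shows "\<exists>c. ennreal q * (\<Sum>k\<in>I. wint p v (Q k) (\<lambda>x. f x - c k)) \<le>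
    e * emeasure lborel (ball 0 r :: 'a set)"
proof -
  have "\<forall>k\<in>I. \<exists>c. ennreal q * wint p v (Q k) (\<lambda>x. f x - c) \<le>
      (\<integral>\<^sup>+z\<in>P k. wint p v (Q k) (\<lambda>x. f x - f z) \<partial>lborel)"
  proof
    fix k assume "k \<in> I"
    then show "\<exists>c. ennreal q * wint p v (Q k) (\<lambda>x. f x - c) \<le>
      (\<integral>\<^sup>+z\<in>P k. wint p v (Q k) (\<lambda>x. f x - f z) \<partial>lborel)"
      using exists_constant_approximation[of v f "P k" "Q k" q p] I q by auto
  qed
  from bchoice[OF this] obtain c where "\<forall>k\<in>I. ennreal q * wint p v (Q k) (\<lambda>x. f x - c k) \<le>
      (\<integral>\<^sup>+z\<in>P k. wint p v (Q k) (\<lambda>x. f x - f z) \<partial>lborel)" ..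
  then have "ennreal q * (\<Sum>k\<in>I. wint p v (Q k) (\<lambda>x. f x - c k)) \<le>
      (\<Sum>k\<in>I. \<integral>\<^sup>+z\<in>P k. wint p v (Q k) (\<lambda>x. f x - f z) \<partial>lborel)"
    by (auto simp: sum_distrib_left intro: sum_mono)
  also have "\<dots> \<le> e * emeasure lborel (ball 0 r :: 'a set)"
    by (rule sum_wint_le_translation) (use assms in auto)
  finally show ?thesis by blast
qed

section \<open>Cubes, and finite nets of coefficient vectors\<close>

text \<open>The two families have different duties. The \<open>Q k\<close> are half-open cells cut
  off by the ball, which they partition exactly. The \<open>P k\<close>, from which the points
  \<open>z\<close> are drawn, are full open cubes, so cells at the rim of the ball do not spoil the
  common measure.\<close>

lemma cube_partition:
  fixes h N :: real
  assumes h: "0 < h"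
  obtains I :: "('a::euclidean_space \<Rightarrow> int) set" and P Q :: "('a \<Rightarrow> int) \<Rightarrow> 'a set"
  where "finite I" "\<And>k. k \<in> I \<Longrightarrow> P k \<in> sets borel" "\<And>k. k \<in> I \<Longrightarrow> Q k \<in> sets borel"
    "\<And>k. k \<in> I \<Longrightarrow> emeasure lborel (P k) = ennreal (h ^ DIM('a))"
    "disjoint_family_on Q I" "(\<Union>k\<in>I. Q k) = ball 0 N"
    "\<And>k x z. k \<in> I \<Longrightarrow> z \<in> P k \<Longrightarrow> x \<in> Q k \<Longrightarrow> dist x z < DIM('a) * h"
proof -
  \<comment> \<open>\<open>restrict\<close> fixes the index outside \<open>Basis\<close>, so that
    the indices met in the ball lie in a finite \<open>PiE\<close>.\<close>
  define cell :: "'a \<Rightarrow> 'a \<Rightarrow> int" where "cell x = restrict (\<lambda>i. \<lfloor>x \<bullet> i / h\<rfloor>) Basis" for x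
  define I where "I = cell ` ball 0 N"
  define P :: "('a \<Rightarrow> int) \<Rightarrow> 'a set"
    where "P k = box (\<Sum>i\<in>Basis. (h * k i) *\<^sub>R i) (\<Sum>i\<in>Basis. (h * (k i + 1)) *\<^sub>R i)" for k
  define Q where "Q k = {x \<in> ball 0 N. cell x = k}" for k
  have "I \<subseteq> Basis \<rightarrow>\<^sub>E {\<lfloor>- N / h\<rfloor>..\<lfloor>N / h\<rfloor>}"
  proof
    fix k assume "k \<in> I"
    then obtain x where x: "norm x < N" "k = cell x" by (auto simp: I_def)
    have "- N / h \<le> x \<bullet> i / h \<and> x \<bullet> i / h \<le> N / h" if "i \<in> Basis" for i
      using Basis_le_norm[OF that, of x] x h by (intro conjI divide_right_mono) auto
    then show "k \<in> Basis \<rightarrow>\<^sub>E {\<lfloor>- N / h\<rfloor>..\<lfloor>N / h\<rfloor>}"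
      by (auto simp: x cell_def intro!: floor_mono)
  qed
  then have fin: "finite I" by (rule finite_subset) (intro finite_PiE finite_Basis finite_atLeastAtMost_int)
  \<comment> \<open>Finitely many floor conditions make measurability visible;
    \<open>k \<in> I\<close> ensures that \<open>k\<close> takes the default value outside
    \<open>Basis\<close>.\<close>
  have Q: "Q k = {x \<in> ball 0 N. \<forall>i\<in>Basis. \<lfloor>x \<bullet> i / h\<rfloor> = k i}" if "k \<in> I" for k
    using that by (force simp: Q_def I_def cell_def restrict_def fun_eq_iff)
  have "Q k \<in> sets borel" if "k \<in> I" for k
    unfolding Q[OF that] by measurable
  moreover have "emeasure lborel (P k) = ennreal (h ^ DIM('a))" for k
  proof -
    let ?a = "\<Sum>i\<in>Basis. (h * k i) *\<^sub>R i" and ?b = "\<Sum>i\<in>Basis. (h * (k i + 1)) *\<^sub>R i"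
    have *: "?a \<bullet> i \<le> ?b \<bullet> i" "(?b - ?a) \<bullet> i = h" if "i \<in> Basis" for i :: 'a
      using that h by (simp_all add: inner_diff_left ring_distribs del: sum.distrib)
    then have "emeasure lborel (P k) = ennreal (\<Prod>i\<in>(Basis :: 'a set). (?b - ?a) \<bullet> i)"
      unfolding P_def by (intro emeasure_lborel_box) auto
    also have "(\<Prod>i\<in>(Basis :: 'a set). (?b - ?a) \<bullet> i) = (\<Prod>i\<in>(Basis :: 'a set). h)"
      using * by (intro prod.cong) auto
    finally show ?thesis by simp
  qed
  moreover have "dist x z < DIM('a) * h" if "k \<in> I" "z \<in> P k" "x \<in> Q k" for k x z
  proof -
    have "\<bar>(x - z) \<bullet> i\<bar> < h" if i: "i \<in> Basis" for i
    proof -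
      have "\<lfloor>x \<bullet> i / h\<rfloor> = k i" using \<open>x \<in> Q k\<close> Q[OF \<open>k \<in> I\<close>] i by auto
      then have "k i \<le> x \<bullet> i / h" "x \<bullet> i / h < k i + 1" by linarith+
      then have "h * k i \<le> x \<bullet> i" "x \<bullet> i < h * (k i + 1)"
        using h by (simp_all add: field_simps)
      moreover have "h * k i < z \<bullet> i" "z \<bullet> i < h * (k i + 1)"
        using \<open>z \<in> P k\<close> i by (auto simp: P_def mem_box)
      ultimately show ?thesis by (simp add: inner_diff_left algebra_simps)
    qed
    then have "(\<Sum>i\<in>Basis. \<bar>(x - z) \<bullet> i\<bar>) < (\<Sum>i\<in>(Basis :: 'a set). h)"
      by (intro sum_strict_mono) auto
    \<comment> \<open>Comparison with the sum of the coordinates is the source of the factor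
      \<open>DIM('a)\<close>.\<close>
    then show ?thesis using norm_le_l1[of "x - z"] by (simp add: dist_norm)
  qed
  moreover have "disjoint_family_on Q I" "(\<Union>k\<in>I. Q k) = ball 0 N"
    by (auto simp: disjoint_family_on_def Q_def I_def)
  ultimately show ?thesis using fin by (intro that[of I P Q]) (auto simp: P_def)
qed

text \<open>Round each coefficient to a finite \<open>\<eta> / 2\<close>-net of the ball. Only
  finitely many rounding patterns occur, and one member of \<open>F\<close> per pattern gives the
  net, since values rounded to the same point differ by less than \<open>\<eta>\<close>.\<close>

lemma finite_net_of_bounded_family:
  fixes u :: "'i \<Rightarrow> 'k \<Rightarrow> 'b::euclidean_space"
  assumes "finite I" "\<And>f k. f \<in> F \<Longrightarrow> k \<in> I \<Longrightarrow> norm (u f k) \<le> R" "0 < \<eta>"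
  obtains J where "finite J" "J \<subseteq> F" "\<And>f. f \<in> F \<Longrightarrow> \<exists>g\<in>J. \<forall>k\<in>I. norm (u f k - u g k) < \<eta>"
proof -
  obtain Z where Z: "finite Z" "cball (0 :: 'b) R \<subseteq> (\<Union>z\<in>Z. ball z (\<eta> / 2))"
    using compact_cball[of "0 :: 'b" R] assms(3) unfolding compact_eq_totally_bounded
    by (meson half_gt_zero)
  then have "\<forall>x\<in>cball 0 R. \<exists>z\<in>Z. dist z x < \<eta> / 2" by (auto simp: subset_iff)
  then obtain n where n: "\<And>x. x \<in> cball 0 R \<Longrightarrow> n x \<in> Z \<and> dist (n x) x < \<eta> / 2" by metis
  define \<phi> where "\<phi> f = restrict (\<lambda>k. n (u f k)) I" for f
  have "\<phi> ` F \<subseteq> I \<rightarrow>\<^sub>E Z" using n assms(2) by (auto simp: \<phi>_def)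
  then have "finite (\<phi> ` F)" by (rule finite_subset) (intro finite_PiE assms Z)
  then obtain J where J: "J \<subseteq> F" "finite J" "\<phi> ` F = \<phi> ` J"
    by (meson finite_subset_image subset_refl)
  have "\<exists>g\<in>J. \<forall>k\<in>I. norm (u f k - u g k) < \<eta>" if f: "f \<in> F" for f
  proof -
    obtain g where g: "g \<in> J" "\<phi> f = \<phi> g" using J f by (metis imageE imageI)
    have "norm (u f k - u g k) < \<eta>" if "k \<in> I" for k
    proof -
      have "n (u f k) = n (u g k)" using fun_cong[OF g(2), of k] that by (simp add: \<phi>_def)
      moreover have "dist (n (u f k)) (u f k) < \<eta> / 2" "dist (n (u g k)) (u g k) < \<eta> / 2"
        using n assms(2) f g J that by auto
      ultimately show ?thesis using dist_triangle_half_r[of "n (u f k)" "u f k" \<eta> "u g k"]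
        by (simp add: dist_norm)
    qed
    with g show ?thesis by blast
  qed
  with J show ?thesis by (intro that) auto
qed

section \<open>Total boundedness for Borel functions\<close>

text \<open>The functions form a family indexed by \<open>F\<close>, so that Borel representatives
  can be used while the net \<open>J\<close> consists of members of \<open>F\<close> itself.\<close>

lemma wint_totally_bounded:
  fixes \<phi> :: "'i \<Rightarrow> 'a::euclidean_space \<Rightarrow> 'b::euclidean_space"
  assumes v[measurable]: "v \<in> borel_measurable borel" and v0: "\<And>x. 0 \<le> v x" and p: "0 < p"
    and \<phi>[measurable]: "\<And>f. f \<in> F \<Longrightarrow> \<phi> f \<in> borel_measurable borel"
    and bounded: "\<And>f. f \<in> F \<Longrightarrow> wint p v UNIV (\<phi> f) \<le> ennreal C"
    and vanishing: "\<And>e. 0 < e \<Longrightarrow> \<exists>N. \<forall>f\<in>F. wint p v (- ball 0 N) (\<phi> f) \<le> ennreal e"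
    and equicontinuous: "\<And>e. 0 < e \<Longrightarrow>
      \<exists>r>0. \<forall>f\<in>F. \<forall>y\<in>ball 0 r. wint p v UNIV (\<lambda>x. \<phi> f (x - y) - \<phi> f x) \<le> ennreal e"
    and e: "0 < e"
  obtains J where "finite J" "J \<subseteq> F"
    "\<And>f. f \<in> F \<Longrightarrow> \<exists>g\<in>J. wint p v UNIV (\<lambda>x. \<phi> f x - \<phi> g x) < ennreal e"
proof -
  define A where "A = 2 powr p"
  have A: "0 < A" by (simp add: A_def)
  \<comment> \<open>At the end \<open>wint_add_le\<close> is applied twice to errors
    \<open>2 * \<delta>\<close>, \<open>\<delta>\<close> and \<open>2 * \<delta>\<close>, for a
    total of \<open>(2 * A + 3 * A\<^sup>2) * \<delta> = e / 2\<close>; the half leaves room for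
    strictness.\<close>
  define \<delta> where "\<delta> = e / (2 * (2 * A + 3 * A\<^sup>2))"
  have \<delta>: "0 < \<delta>" using e A by (auto simp: \<delta>_def intro!: divide_pos_pos add_pos_pos)
  \<comment> \<open>The volume of a ball of radius \<open>r\<close> divided by that of a cube of
    side \<open>r / DIM('a)\<close>. It does not depend on \<open>r\<close>, so the tolerance
    \<open>\<delta> / K\<close> can be fixed before \<open>r\<close>.\<close>
  define K where "K = unit_ball_vol (DIM('a)) * DIM('a) ^ DIM('a)"
  have K: "0 < K" by (simp add: K_def unit_ball_vol_pos)
  obtain N where N: "\<And>f. f \<in> F \<Longrightarrow> wint p v (- ball 0 N) (\<phi> f) \<le> ennreal \<delta>"
    using vanishing[OF \<delta>] by blast
  have "0 < \<delta> / K" using \<delta> K by simp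
  from equicontinuous[OF this] obtain r where r: "0 < r"
    "\<And>f y. f \<in> F \<Longrightarrow> y \<in> ball 0 r \<Longrightarrow> wint p v UNIV (\<lambda>x. \<phi> f (x - y) - \<phi> f x) \<le> ennreal (\<delta> / K)"
    by blast
  define h where "h = r / DIM('a)"
  have h: "0 < h" "DIM('a) * h = r" using r by (simp_all add: h_def)
  obtain I :: "('a \<Rightarrow> int) set" and P Q :: "('a \<Rightarrow> int) \<Rightarrow> 'a set"
    where I: "finite I" "\<And>k. k \<in> I \<Longrightarrow> P k \<in> sets borel" "\<And>k. k \<in> I \<Longrightarrow> Q k \<in> sets borel"
      and P: "\<And>k. k \<in> I \<Longrightarrow> emeasure lborel (P k) = ennreal (h ^ DIM('a))"
      and Q: "disjoint_family_on Q I" "(\<Union>k\<in>I. Q k) = ball 0 N"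
      and near: "\<And>k x z. k \<in> I \<Longrightarrow> z \<in> P k \<Longrightarrow> x \<in> Q k \<Longrightarrow> dist x z < r"
    by (rule cube_partition[OF h(1), where N = N and 'a = 'a, unfolded h(2)]) (rule that, assumption+)
  note [measurable] = I(3)
  have "emeasure lborel (ball 0 r :: 'a set) = ennreal (K * h ^ DIM('a))"
    using r by (simp add: emeasure_ball K_def h(2)[symmetric] power_mult_distrib mult.assoc)
  then have ball: "ennreal (\<delta> / K) * emeasure lborel (ball 0 r :: 'a set) = ennreal (h ^ DIM('a)) * ennreal \<delta>"
    using K \<delta> h by (simp flip: ennreal_mult')
  have "\<forall>f\<in>F. \<exists>c. (\<Sum>k\<in>I. wint p v (Q k) (\<lambda>x. \<phi> f x - c k)) \<le> ennreal \<delta>"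
  proof
    fix f assume f: "f \<in> F"
    have "\<exists>c. ennreal (h ^ DIM('a)) * (\<Sum>k\<in>I. wint p v (Q k) (\<lambda>x. \<phi> f x - c k)) \<le>
      ennreal (\<delta> / K) * emeasure lborel (ball 0 r :: 'a set)"
      by (rule exists_step_approximation[OF v \<phi>[OF f] I Q(1) P _ near r(2)[OF f]]) (use h in auto)
    then show "\<exists>c. (\<Sum>k\<in>I. wint p v (Q k) (\<lambda>x. \<phi> f x - c k)) \<le> ennreal \<delta>"
      unfolding ball using h by (subst (asm) ennreal_mult_le_mult_iff) auto
  qed
  from bchoice[OF this] obtain c
    where c: "\<And>f. f \<in> F \<Longrightarrow> (\<Sum>k\<in>I. wint p v (Q k) (\<lambda>x. \<phi> f x - c f k)) \<le> ennreal \<delta>"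
    by blast
  \<comment> \<open>The weight of a cell, which may be infinite even though the cell is
    bounded.\<close>
  define m where "m k = (\<integral>\<^sup>+x\<in>Q k. ennreal (v x) \<partial>lborel)" for k
  define R where "R = A * (\<delta> + max C 0)"
  \<comment> \<open>Writing the constant as \<open>(c f k - \<phi> f x) + \<phi> f x\<close> bounds
    it by the approximation error and the bound on the family. If \<open>m k\<close> is infinite,
    this forces \<open>c f k = 0\<close>.\<close>
  have weight: "ennreal (norm (c f k) powr p) * m k \<le> ennreal R" if f: "f \<in> F" and k: "k \<in> I" for f k
  proof -
    have "ennreal (norm (c f k) powr p) * m k = wint p v (Q k) (\<lambda>x. (c f k - \<phi> f x) + \<phi> f x)"
      using k by (simp add: wint_const v0 m_def)
    also have "\<dots> \<le> ennreal A * (wint p v (Q k) (\<lambda>x. c f k - \<phi> f x) + wint p v (Q k) (\<phi> f))"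
      unfolding A_def using f k p by (intro wint_add_le v0) auto
    also have "\<dots> \<le> ennreal A * (ennreal \<delta> + ennreal (max C 0))"
    proof (intro mult_left_mono add_mono)
      have "wint p v (Q k) (\<lambda>x. \<phi> f x - c f k) \<le> (\<Sum>k\<in>I. wint p v (Q k) (\<lambda>x. \<phi> f x - c f k))"
        using k I by (intro member_le_sum) auto
      then show "wint p v (Q k) (\<lambda>x. c f k - \<phi> f x) \<le> ennreal \<delta>"
        using c[OF f] by (subst wint_minus_commute) (rule order_trans)
      show "wint p v (Q k) (\<phi> f) \<le> ennreal (max C 0)"
        using order_trans[OF wint_mono_set bounded[OF f], of "Q k"]
        by (auto intro: order_trans simp: ennreal_leI)
    qed auto
    also have "\<dots> = ennreal R"
      using A \<delta> by (simp add: R_def flip: ennreal_plus ennreal_mult')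
    finally show ?thesis .
  qed
  \<comment> \<open>For finite \<open>m k\<close> the p-th power of \<open>norm (u f k)\<close> is
    the weighted integral of the constant over the cell. Since \<open>enn2real\<close> sends
    infinity to 0, \<open>u\<close> ignores cells of infinite weight, where the constants vanish
    anyway.\<close>
  define u where "u f k = enn2real (m k) powr (1 / p) *\<^sub>R c f k" for f k
  have scale: "norm (enn2real (m k) powr (1 / p) *\<^sub>R x) powr p = norm x powr p * enn2real (m k)" for x :: 'b and k
    using p by (simp add: powr_mult powr_powr)
  have fin: "ennreal x * m k = ennreal (x * enn2real (m k))" if "m k < top" "0 \<le> x" for x k
    using that by (simp add: ennreal_mult)
  have u: "norm (u f k) \<le> R powr (1 / p)" if f: "f \<in> F" and k: "k \<in> I" for f k
  proof -
    have R: "0 \<le> R" using A \<delta> by (simp add: R_def)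
    have "norm (u f k) powr p \<le> R"
    proof (cases "m k < top")
      case True
      then show ?thesis using weight[OF f k] R by (simp add: u_def scale fin del: norm_scaleR)
    next
      case False
      then have "m k = top" by (simp add: not_less top_unique)
      then show ?thesis using R p by (simp add: u_def)
    qed
    then have "(norm (u f k) powr p) powr (1 / p) \<le> R powr (1 / p)"
      using p by (intro powr_mono2) auto
    then show ?thesis using p by (simp add: powr_powr)
  qed
  \<comment> \<open>Each cell may then contribute \<open>\<delta> / (card I + 1)\<close>, at most
    \<open>\<delta>\<close> in all; the 1 covers an empty \<open>I\<close>.\<close>
  define \<eta> where "\<eta> = (\<delta> / (card I + 1)) powr (1 / p)"
  have \<eta>: "0 < \<eta>" using \<delta> by (simp add: \<eta>_def)
  obtain J where J: "finite J" "J \<subseteq> F" "\<And>f. f \<in> F \<Longrightarrow> \<exists>g\<in>J. \<forall>k\<in>I. norm (u f k - u g k) < \<eta>"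
    by (rule finite_net_of_bounded_family[where u = u and F = F, OF I(1) u \<eta>]) (assumption | rule that)+
  define T where "T f x = (\<Sum>k\<in>I. indicator (Q k) x *\<^sub>R c f k)" for f x
  have [measurable]: "T f \<in> borel_measurable borel" for f
    unfolding T_def by measurable
  have T_in: "T f x = c f k" if "k \<in> I" "x \<in> Q k" for f k x
  proof -
    have "T f x = (\<Sum>j\<in>I. if j = k then c f k else 0)"
      unfolding T_def using that Q(1)
      by (intro sum.cong) (auto simp: disjoint_family_on_def split: split_indicator)
    then show ?thesis using that I by simp
  qed
  have T_out: "T f x = 0" if "x \<notin> ball 0 N" for f x
    unfolding T_def using that Q(2) by (intro sum.neutral) (auto split: split_indicator)
  have split: "wint p v UNIV g = (\<Sum>k\<in>I. wint p v (Q k) g) + wint p v (- ball 0 N) g"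
    if [measurable]: "g \<in> borel_measurable borel" for g :: "'a \<Rightarrow> 'b"
    using wint_Compl[of v g "ball 0 N" p] wint_UN_disjoint[of v g I Q p] I Q by auto
  \<comment> \<open>One \<open>\<delta>\<close> comes from the cells, the other from the tail
    outside the ball, where \<open>T f\<close> is zero.\<close>
  have step: "wint p v UNIV (\<lambda>x. \<phi> f x - T f x) \<le> ennreal (2 * \<delta>)" if f: "f \<in> F" for f
  proof -
    have "(\<Sum>k\<in>I. wint p v (Q k) (\<lambda>x. \<phi> f x - T f x)) = (\<Sum>k\<in>I. wint p v (Q k) (\<lambda>x. \<phi> f x - c f k))"
      by (intro sum.cong wint_cong) (auto simp: T_in)
    moreover have "wint p v (- ball 0 N) (\<lambda>x. \<phi> f x - T f x) = wint p v (- ball 0 N) (\<phi> f)"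
      by (intro wint_cong) (auto simp: T_out)
    ultimately have "wint p v UNIV (\<lambda>x. \<phi> f x - T f x) \<le> ennreal \<delta> + ennreal \<delta>"
      using c[OF f] N[OF f] f by (subst split) (auto intro: add_mono)
    then show ?thesis using \<delta> by (simp flip: ennreal_plus)
  qed
  have mid: "wint p v UNIV (\<lambda>x. T f x - T g x) \<le> ennreal \<delta>"
    if f: "f \<in> F" and g: "g \<in> F" and close: "\<And>k. k \<in> I \<Longrightarrow> norm (u f k - u g k) < \<eta>" for f g
  proof -
    have "wint p v (Q k) (\<lambda>x. T f x - T g x) \<le> ennreal (\<delta> / (card I + 1))" if k: "k \<in> I" for k
    proof -
      have "wint p v (Q k) (\<lambda>x. T f x - T g x) = wint p v (Q k) (\<lambda>x. c f k - c g k)"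
        by (intro wint_cong) (simp add: T_in[OF k])
      also have "\<dots> = ennreal (norm (c f k - c g k) powr p) * m k"
        using k by (simp add: wint_const v0 m_def)
      also have "\<dots> \<le> ennreal (\<delta> / (card I + 1))"
      proof (cases "m k < top")
        case True
        have "norm (c f k - c g k) powr p * enn2real (m k) = norm (u f k - u g k) powr p"
          by (simp only: u_def scale flip: scaleR_diff_right)
        also have "\<dots> \<le> \<eta> powr p"
          using close[OF k] p by (intro powr_mono2) auto
        also have "\<dots> = \<delta> / (card I + 1)" using p \<delta> by (simp add: \<eta>_def powr_powr)
        finally show ?thesis using True by (simp add: fin ennreal_leI)
      next
        case False
        then have "m k = top" by (simp add: not_less top_unique)
        then have "c f k = 0" "c g k = 0"
          using weight[OF f k] weight[OF g k] by (auto simp: ennreal_mult_top top_unique split: if_splits)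
        then show ?thesis by simp
      qed
      finally show ?thesis .
    qed
    then have "(\<Sum>k\<in>I. wint p v (Q k) (\<lambda>x. T f x - T g x)) \<le> (\<Sum>k\<in>I. ennreal (\<delta> / (card I + 1)))"
      by (intro sum_mono)
    also have "\<dots> = ennreal (card I * (\<delta> / (card I + 1)))"
      using \<delta> by (simp add: ennreal_of_nat_eq_real_of_nat flip: ennreal_mult)
    also have "\<dots> \<le> ennreal \<delta>" using \<delta> by (intro ennreal_leI) (simp add: field_simps)
    moreover have "wint p v (- ball 0 N) (\<lambda>x. T f x - T g x) = 0"
      by (subst wint_cong[where g = "\<lambda>_. 0"]) (auto simp: T_out wint_def)
    ultimately show ?thesis by (subst split) auto
  qed
  have "\<exists>g\<in>J. wint p v UNIV (\<lambda>x. \<phi> f x - \<phi> g x) < ennreal e" if f: "f \<in> F" for f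
  proof -
    obtain g where g: "g \<in> J" "\<And>k. k \<in> I \<Longrightarrow> norm (u f k - u g k) < \<eta>" using J(3)[OF f] by blast
    then have gF: "g \<in> F" using J by auto
    note [measurable] = \<phi>[OF f] \<phi>[OF gF]
    let ?W = "wint p v UNIV"
    have "?W (\<lambda>x. \<phi> f x - \<phi> g x) = ?W (\<lambda>x. (\<phi> f x - T f x) + ((T f x - T g x) + (T g x - \<phi> g x)))"
      by simp
    also have "\<dots> \<le> ennreal A * (?W (\<lambda>x. \<phi> f x - T f x) + ?W (\<lambda>x. (T f x - T g x) + (T g x - \<phi> g x)))"
      unfolding A_def using p by (intro wint_add_le v0) auto
    also have "\<dots> \<le> ennreal A * (?W (\<lambda>x. \<phi> f x - T f x) + ennreal A * (?W (\<lambda>x. T f x - T g x) + ?W (\<lambda>x. T g x - \<phi> g x)))"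
      unfolding A_def using p by (intro mult_left_mono add_left_mono wint_add_le v0) auto
    also have "\<dots> \<le> ennreal A * (ennreal (2 * \<delta>) + ennreal A * (ennreal \<delta> + ennreal (2 * \<delta>)))"
      using step[OF f] step[OF gF] mid[OF f gF g(2)]
      by (intro mult_left_mono add_mono) (auto simp: wint_minus_commute[of p v UNIV "T g"])
    also have "\<dots> = ennreal (A * (2 * \<delta> + A * (\<delta> + 2 * \<delta>)))"
      using A \<delta> by (simp flip: ennreal_plus ennreal_mult)
    also have "A * (2 * \<delta> + A * (\<delta> + 2 * \<delta>)) = (2 * A + 3 * A\<^sup>2) * \<delta>"
      by (simp add: power2_eq_square algebra_simps)
    also have "\<dots> = e / 2"
    proof -
      have "2 * A + 3 * A\<^sup>2 \<noteq> 0" using A by (smt (verit) zero_le_power2)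
      then show ?thesis unfolding \<delta>_def by (simp add: divide_simps)
    qed
    also have "ennreal (e / 2) < ennreal e" using e by (intro ennreal_lessI) auto
    finally show ?thesis using g by blast
  qed
  with J show ?thesis by (intro that) auto
qed

section \<open>From Lebesgue functions and the seminorm to Borel integrals\<close>

text \<open>Coordinates reduce this to real functions, and the exceptional null sets of finitely
  many coordinates are united.\<close>

lemma completion_ex_borel_measurable_euclidean:
  fixes g :: "'a \<Rightarrow> 'b::euclidean_space"
  assumes [measurable]: "g \<in> borel_measurable (completion M)"
  shows "\<exists>g'\<in>borel_measurable M. AE x in M. g x = g' x"
proof -
  have "\<exists>g'\<in>borel_measurable M. AE x in M. g x \<bullet> i = g' x" for i
    by (rule completion_ex_borel_measurable_real) measurable
  then obtain g' where g'[measurable]: "\<And>i. g' i \<in> borel_measurable M"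
    and ae: "\<And>i. AE x in M. g x \<bullet> i = g' i x" by metis
  have "AE x in M. \<forall>i\<in>Basis. g x \<bullet> i = g' i x"
    using ae by (intro AE_finite_allI) auto
  then have "AE x in M. g x = (\<Sum>i\<in>Basis. g' i x *\<^sub>R i)"
    by eventually_elim (metis (no_types, lifting) euclidean_representation sum.cong)
  then show ?thesis
    by (intro bexI[of _ "\<lambda>x. \<Sum>i\<in>Basis. g' i x *\<^sub>R i"]) measurable
qed

text \<open>By translation invariance, passing to a Borel representative changes a translate only on
  a null set as well.\<close>

lemma AE_lborel_shift:
  fixes y :: "'a::euclidean_space"
  assumes "AE x in lborel. P x"
  shows "AE x in lborel. P (x - y)"
proof -
  have "AE x in distr lborel borel ((+) (- y)). P x"
    using assms by (subst lborel_distr_plus)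
  then have "AE x in lborel. P (- y + x)"
    by (rule AE_distrD[rotated]) simp
  then show ?thesis by simp
qed

text \<open>This and the strict version below move bounds between the seminorm and
  \<open>wint\<close>; the root of infinity is infinity, so divergent integrals are covered.\<close>

lemma ennreal_root_le_iff:
  assumes "0 < p" "0 \<le> d"
  shows "ennreal_root p a \<le> ennreal d \<longleftrightarrow> a \<le> ennreal (d powr p)"
proof (cases a)
  case (real x)
  have "x powr (1 / p) \<le> d \<longleftrightarrow> x \<le> d powr p"
  proof
    assume "x powr (1 / p) \<le> d"
    then have "(x powr (1 / p)) powr p \<le> d powr p" using assms by (intro powr_mono2) auto
    then show "x \<le> d powr p" using assms real by (simp add: powr_powr)
  next
    assume "x \<le> d powr p"
    then have "x powr (1 / p) \<le> (d powr p) powr (1 / p)" using assms real by (intro powr_mono2) auto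
    then show "x powr (1 / p) \<le> d" using assms by (simp add: powr_powr)
  qed
  then show ?thesis using real assms by (simp add: ennreal_root_def)
next
  case top
  then show ?thesis by (simp add: ennreal_root_def top_unique)
qed

lemma ennreal_root_less_iff:
  assumes "0 < p" "0 \<le> d"
  shows "ennreal_root p a < ennreal d \<longleftrightarrow> a < ennreal (d powr p)"
proof (cases a)
  case (real x)
  have "x powr (1 / p) < d \<longleftrightarrow> x < d powr p"
  proof
    assume "x powr (1 / p) < d"
    then have "(x powr (1 / p)) powr p < d powr p" using assms by (intro powr_less_mono2) auto
    then show "x < d powr p" using assms real by (simp add: powr_powr)
  next
    assume "x < d powr p"
    then have "x powr (1 / p) < (d powr p) powr (1 / p)" using assms real by (intro powr_less_mono2) auto
    then show "x powr (1 / p) < d" using assms by (simp add: powr_powr)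
  qed
  then show ?thesis using real assms by (simp add: ennreal_root_def ennreal_less_iff)
next
  case top
  then show ?thesis by (simp add: ennreal_root_def)
qed

lemma wnorm_eq_wint:
  fixes v :: "real ^ 'n \<Rightarrow> real" and f :: "real ^ 'n \<Rightarrow> 'b::{real_normed_field, euclidean_space}"
  assumes "AE x in lborel. v x = w x" "AE x in lborel. f x = g x"
  shows "wnorm p v f = ennreal_root p (wint p w UNIV g)"
  unfolding wnorm_def wint_def nn_integral_completion
  by (intro arg_cong[where f = "ennreal_root p"] nn_integral_cong_AE)
    (use assms in eventually_elim, simp)

theorem theorem3p3:
  fixes p :: real
    and v :: "real ^ 'n \<Rightarrow> real"
    and F :: "(real ^ 'n \<Rightarrow> 'b::{real_normed_field, euclidean_space}) set"
  assumes p: "1 \<le> p"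
    and v: "v \<in> L0" "AE x in lebesgue. 0 \<le> v x"
    and F: "F \<subseteq> Lpv p v"
    and bounded: "(SUP f\<in>F. wnorm p v f) < \<infinity>"
    and vanishing: "((\<lambda>N::real. SUP f\<in>F. wnorm p v (\<lambda>x. f x * indicator (- ball 0 N) x)) \<longlongrightarrow> 0) at_top"
    and equicontinuous: "((\<lambda>r::real. SUP f\<in>F. SUP y\<in>ball 0 r. wnorm p v (\<lambda>x. translation y f x - f x)) \<longlongrightarrow> 0) (at_right 0)"
  shows "Lpv_totally_bounded p v F"
proof -
  have p0: "0 < p" using p by simp
  obtain v' where v'[measurable]: "v' \<in> borel_measurable lborel" and vv': "AE x in lborel. v x = v' x"
    using completion_ex_borel_measurable_real[of v lborel] v(1) by (auto simp: L0_def)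
  \<comment> \<open>The Borel version of \<open>v\<close> may be negative on a null set; truncation
    gives nonnegativity everywhere.\<close>
  define w where "w x = max 0 (v' x)" for x
  have w[measurable]: "w \<in> borel_measurable borel" and w0: "\<And>x. 0 \<le> w x"
    using v' unfolding w_def by auto
  have "AE x in lborel. 0 \<le> v x" using v(2) by (simp add: AE_completion_iff)
  with vv' have vw: "AE x in lborel. v x = w x" by eventually_elim (simp add: w_def)
  have "\<forall>f\<in>F. \<exists>g. g \<in> borel_measurable borel \<and> (AE x in lborel. f x = g x)"
  proof
    fix f assume "f \<in> F"
    then have "f \<in> borel_measurable lebesgue" using F by (auto simp: Lpv_def L0_def)
    then show "\<exists>g. g \<in> borel_measurable borel \<and> (AE x in lborel. f x = g x)"
      using completion_ex_borel_measurable_euclidean[of f lborel] by auto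
  qed
  from bchoice[OF this] obtain \<phi> where \<phi>: "\<And>f. f \<in> F \<Longrightarrow> \<phi> f \<in> borel_measurable borel"
    and ae: "\<And>f. f \<in> F \<Longrightarrow> AE x in lborel. f x = \<phi> f x" by blast
  have tail: "wnorm p v (\<lambda>x. f x * indicator (- ball 0 N) x) = ennreal_root p (wint p w (- ball 0 N) (\<phi> f))"
    if "f \<in> F" for f N
  proof -
    have "wnorm p v (\<lambda>x. f x * indicator (- ball 0 N) x) =
        ennreal_root p (wint p w UNIV (\<lambda>x. \<phi> f x * indicator (- ball 0 N) x))"
      by (rule wnorm_eq_wint[OF vw]) (use ae[OF that] in eventually_elim, simp)
    also have "wint p w UNIV (\<lambda>x. \<phi> f x * indicator (- ball 0 N) x) = wint p w (- ball 0 N) (\<phi> f)"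
      unfolding wint_def by (intro nn_integral_cong) (auto split: split_indicator)
    finally show ?thesis .
  qed
  have transl: "wnorm p v (\<lambda>x. translation y f x - f x) = ennreal_root p (wint p w UNIV (\<lambda>x. \<phi> f (x - y) - \<phi> f x))"
    if "f \<in> F" for f y
    by (rule wnorm_eq_wint[OF vw])
      (use ae[OF that] AE_lborel_shift[OF ae[OF that], of y] in eventually_elim, simp add: translation_def)
  have diff: "wnorm p v (\<lambda>x. f x - g x) = ennreal_root p (wint p w UNIV (\<lambda>x. \<phi> f x - \<phi> g x))"
    if "f \<in> F" "g \<in> F" for f g
    by (rule wnorm_eq_wint[OF vw]) (use ae[OF that(1)] ae[OF that(2)] in eventually_elim, simp)
  obtain C where C: "0 \<le> C" "(SUP f\<in>F. wnorm p v f) = ennreal C"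
    using bounded by (cases "SUP f\<in>F. wnorm p v f") auto
  have bounded': "wint p w UNIV (\<phi> f) \<le> ennreal (C powr p)" if "f \<in> F" for f
  proof -
    have "wnorm p v f \<le> ennreal C" using that unfolding C(2)[symmetric] by (rule SUP_upper)
    then show ?thesis
      using wnorm_eq_wint[OF vw ae[OF that]] ennreal_root_le_iff[OF p0 C(1)] by simp
  qed
  have vanishing': "\<exists>N. \<forall>f\<in>F. wint p w (- ball 0 N) (\<phi> f) \<le> ennreal e" if "0 < e" for e
  proof -
    \<comment> \<open>The p-th root of \<open>e\<close>: a seminorm bound by \<open>?d\<close> is a
      bound by \<open>e\<close> on \<open>wint\<close>.\<close>
    let ?d = "e powr (1 / p)"
    have d: "0 < ?d" "?d powr p = e" using that p0 by (auto simp: powr_powr)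
    have "\<forall>\<^sub>F N in at_top. (SUP f\<in>F. wnorm p v (\<lambda>x. f x * indicator (- ball 0 N) x)) < ennreal ?d"
      using vanishing d by (intro order_tendstoD) auto
    then obtain N where N: "(SUP f\<in>F. wnorm p v (\<lambda>x. f x * indicator (- ball 0 N) x)) < ennreal ?d"
      using eventually_happens' trivial_limit_at_top_linorder by blast
    have "wint p w (- ball 0 N) (\<phi> f) \<le> ennreal e" if f: "f \<in> F" for f
    proof -
      have "wnorm p v (\<lambda>x. f x * indicator (- ball 0 N) x) \<le> ennreal ?d"
        by (rule order_trans[OF SUP_upper[OF f] less_imp_le[OF N]])
      then show ?thesis using tail[OF f] ennreal_root_le_iff[OF p0, of ?d] d by simp
    qed
    then show ?thesis by blast
  qed
  have equicontinuous': "\<exists>r>0. \<forall>f\<in>F. \<forall>y\<in>ball 0 r. wint p w UNIV (\<lambda>x. \<phi> f (x - y) - \<phi> f x) \<le> ennreal e"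
    if "0 < e" for e
  proof -
    let ?d = "e powr (1 / p)"
    let ?S = "\<lambda>r::real. SUP f\<in>F. SUP y\<in>ball 0 r. wnorm p v (\<lambda>x. translation y f x - f x)"
    have d: "0 < ?d" "?d powr p = e" using that p0 by (auto simp: powr_powr)
    have "\<forall>\<^sub>F r in at_right 0. ?S r < ennreal ?d \<and> 0 < r"
      using d by (intro eventually_conj order_tendstoD(2)[OF equicontinuous] eventually_at_right_less) simp
    then obtain r where r: "?S r < ennreal ?d" "0 < r"
      using eventually_happens'[OF trivial_limit_at_right_real] by blast
    have "wint p w UNIV (\<lambda>x. \<phi> f (x - y) - \<phi> f x) \<le> ennreal e" if f: "f \<in> F" and y: "y \<in> ball 0 r" for f y
    proof -
      have "wnorm p v (\<lambda>x. translation y f x - f x) \<le> ennreal ?d"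
        by (rule order_trans[OF SUP_upper2[OF f SUP_upper[OF y]] less_imp_le[OF r(1)]])
      then show ?thesis using transl[OF f] ennreal_root_le_iff[OF p0, of ?d] d by simp
    qed
    with r(2) show ?thesis by blast
  qed
  have "\<exists>K. finite K \<and> K \<subseteq> F \<and> (\<forall>f\<in>F. \<exists>g\<in>K. wnorm p v (\<lambda>x. f x - g x) < ennreal \<epsilon>)"
    if \<epsilon>: "0 < \<epsilon>" for \<epsilon>
  proof -
    \<comment> \<open>The net is taken at tolerance \<open>\<epsilon> powr p\<close> because
      \<open>wint\<close> is the p-th power of the seminorm.\<close>
    have "0 < \<epsilon> powr p" using \<epsilon> by simp
    from wint_totally_bounded[OF w w0 p0 \<phi> bounded' vanishing' equicontinuous' this]
    obtain J where J: "finite J" "J \<subseteq> F"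
      "\<And>f. f \<in> F \<Longrightarrow> \<exists>g\<in>J. wint p w UNIV (\<lambda>x. \<phi> f x - \<phi> g x) < ennreal (\<epsilon> powr p)"
      by blast
    have "\<exists>g\<in>J. wnorm p v (\<lambda>x. f x - g x) < ennreal \<epsilon>" if f: "f \<in> F" for f
    proof -
      obtain g where g: "g \<in> J" "wint p w UNIV (\<lambda>x. \<phi> f x - \<phi> g x) < ennreal (\<epsilon> powr p)"
        using J(3)[OF f] by blast
      then have "g \<in> F" using J(2) by blast
      then show ?thesis using g f diff ennreal_root_less_iff[OF p0, of \<epsilon>] \<epsilon> by (intro bexI[of _ g]) auto
    qed
    with J show ?thesis by blast
  qed
  with F show ?thesis by (simp add: Lpv_totally_bounded_def)
qed

end
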